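(* For all integers $r\geq 2$, $\mathcal{B}_{r,r}=\mathcal{D}_{r,r}$.
   Context: A partition is a non-increasing finite sequence of positive integers (possibly empty). For a partition $\mu=(\mu_1,\dots,\mu_t)$ let $\mathrm{sq}(\mu)=\max\{d\ge0: d\le t,\ \mu_d\ge d\}$ (side of the Durfee square). $\mathcal{D}_{r,r}$ is the set of partitions $\lambda$ such that, setting $\mu^{(0)}=\lambda$ and letting $\mu^{(j)}$ be $\mu^{(j-1)}$ with its first $\mathrm{sq}(\mu^{(j-1)})$ parts deleted, $\mu^{(r-1)}$ is empty (i.e. $\lambda$ has at most $r-1$ successive non-empty Durfee squares). $\mathcal{B}_{r,r}$ is the set of partitions $\lambda$ such that, setting $\nu^{(0)}=\lambda$ and letting $\nu^{(j)}$ be obtained from $\nu^{(j-1)}=(\nu_1,\dots,\nu_t)$ by deleting its last $\min(\nu_t,t)$ parts (removal of the bottom square of side $\nu_t$; nothing is done if $\nu^{(j-1)}$ is empty), $\nu^{(r-1)}$ is empty. *)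

theory Defs
  imports Main
begin

definition is_partition :: "nat list \<Rightarrow> bool" where
  "is_partition xs \<longleftrightarrow> sorted_wrt (\<ge>) xs \<and> (\<forall>x \<in> set xs. 0 < x)"

(* The part mu_d is mu ! (d - 1). There is no part mu_0: d = 0 is always admitted, so that the
   maximum is over a nonempty set and the empty partition has Durfee square of side 0. *)
definition durfee :: "nat list \<Rightarrow> nat" where
  "durfee \<mu> = Max {d. d \<le> length \<mu> \<and> (0 < d \<longrightarrow> d \<le> \<mu> ! (d - 1))}"

definition remove_durfee :: "nat list \<Rightarrow> nat list" where
  "remove_durfee \<mu> = drop (durfee \<mu>) \<mu>"

definition remove_bottom :: "nat list \<Rightarrow> nat list" where
  "remove_bottom \<nu> =
     (if \<nu> = [] then [] else take (length \<nu> - min (last \<nu>) (length \<nu>)) \<nu>)"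

(* The diagonal cases of the two-parameter families D_{r,i} and B_{r,i}. *)
definition D_diag :: "nat \<Rightarrow> nat list set" where
  "D_diag r = {xs. is_partition xs \<and> (remove_durfee ^^ (r - 1)) xs = []}"

definition B_diag :: "nat \<Rightarrow> nat list set" where
  "B_diag r = {xs. is_partition xs \<and> (remove_bottom ^^ (r - 1)) xs = []}"

end

theory Submission
  imports Defs
begin

text \<open>
  Call a list of parts a block if each of its parts is at least its length. Removing the Durfee
  square deletes the longest prefix that is a block, and removing the bottom square deletes the
  longest suffix that is a block. Since every sublist of a block is a block, both greedy procedures
  are optimal: either one empties a partition within k steps if and only if the partition is a
  concatenation of k (possibly empty) blocks, a condition that does not refer to a direction.
\<close>

definition block :: "nat list \<Rightarrow> bool" where
  "block b \<longleftrightarrow> (\<forall>x \<in> set b. length b \<le> x)"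

text \<open>Since \<open>[]\<close> is a block, exactly \<open>k\<close> blocks amounts to at most
  \<open>k\<close>, just as further removal steps leave the empty list unchanged.\<close>

definition concat_of_blocks :: "nat \<Rightarrow> nat list \<Rightarrow> bool" where
  "concat_of_blocks k xs \<longleftrightarrow> (\<exists>bs. length bs = k \<and> concat bs = xs \<and> (\<forall>b \<in> set bs. block b))"

lemma block_take: "block b \<Longrightarrow> block (take m b)"
  unfolding block_def using set_take_subset[of m b] by fastforce

lemma block_drop: "block b \<Longrightarrow> block (drop m b)"
  unfolding block_def using set_drop_subset[of m b] by fastforce

lemma concat_of_blocks_0: "concat_of_blocks 0 xs \<longleftrightarrow> xs = []"
  unfolding concat_of_blocks_def by auto

lemma concat_of_blocks_Suc:
  "concat_of_blocks (Suc k) xs \<longleftrightarrow> (\<exists>ys zs. xs = ys @ zs \<and> block ys \<and> concat_of_blocks k zs)"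
  unfolding concat_of_blocks_def by (fastforce simp: length_Suc_conv)

text \<open>Splitting off the last block instead of the first serves removal from the bottom; both
  splittings describe the same predicate, which is what links the two procedures.\<close>

lemma concat_of_blocks_Suc_snoc:
  "concat_of_blocks (Suc k) xs \<longleftrightarrow> (\<exists>ys zs. xs = ys @ zs \<and> concat_of_blocks k ys \<and> block zs)"
proof
  assume "concat_of_blocks (Suc k) xs"
  then obtain bs where "length bs = Suc k" "concat bs = xs" "\<forall>b \<in> set bs. block b"
    unfolding concat_of_blocks_def by blast
  moreover from this obtain cs c where "bs = cs @ [c]"
    by (cases bs rule: rev_cases) auto
  ultimately show "\<exists>ys zs. xs = ys @ zs \<and> concat_of_blocks k ys \<and> block zs"
    unfolding concat_of_blocks_def by auto
next
  assume "\<exists>ys zs. xs = ys @ zs \<and> concat_of_blocks k ys \<and> block zs"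
  then obtain bs c where "length bs = k" "xs = concat bs @ c" "\<forall>b \<in> set bs. block b" "block c"
    unfolding concat_of_blocks_def by blast
  then show "concat_of_blocks (Suc k) xs"
    unfolding concat_of_blocks_def by (intro exI[of _ "bs @ [c]"]) auto
qed

text \<open>A cut shortens one block and empties all blocks before it, and the results are still
  blocks. Hence deleting more than the first block does no harm.\<close>

lemma concat_of_blocks_drop: "concat_of_blocks k xs \<Longrightarrow> concat_of_blocks k (drop m xs)"
proof (induction k arbitrary: xs m)
  case (Suc k)
  then obtain ys zs where "xs = ys @ zs" "block ys" "concat_of_blocks k zs"
    unfolding concat_of_blocks_Suc by blast
  \<comment> \<open>Truncated subtraction covers both positions of the cut: within \<open>ys\<close>
    the second summand is all of \<open>zs\<close>, beyond \<open>ys\<close> the first is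
    empty.\<close>
  then have "drop m xs = drop m ys @ drop (m - length ys) zs"
    "block (drop m ys)" "concat_of_blocks k (drop (m - length ys) zs)"
    by (simp_all add: block_drop Suc.IH)
  then show ?case
    unfolding concat_of_blocks_Suc by blast
qed (simp add: concat_of_blocks_0)

lemma concat_of_blocks_take: "concat_of_blocks k xs \<Longrightarrow> concat_of_blocks k (take m xs)"
proof (induction k arbitrary: xs m)
  case (Suc k)
  then obtain ys zs where "xs = ys @ zs" "block ys" "concat_of_blocks k zs"
    unfolding concat_of_blocks_Suc by blast
  then have "take m xs = take m ys @ take (m - length ys) zs"
    "block (take m ys)" "concat_of_blocks k (take (m - length ys) zs)"
    by (simp_all add: block_take Suc.IH)
  then show ?case
    unfolding concat_of_blocks_Suc by blast
qed (simp add: concat_of_blocks_0)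

lemma is_partition_take: "is_partition xs \<Longrightarrow> is_partition (take m xs)"
  unfolding is_partition_def by (auto simp: sorted_wrt_take dest: in_set_takeD)

lemma is_partition_drop: "is_partition xs \<Longrightarrow> is_partition (drop m xs)"
  unfolding is_partition_def by (auto simp: sorted_wrt_drop dest: in_set_dropD)

lemma is_partition_nth_antimono:
  assumes "is_partition xs" "i \<le> j" "j < length xs"
  shows "xs ! j \<le> xs ! i"
  using assms sorted_wrt_nth_less[of "(\<ge>)" xs i j] unfolding is_partition_def
  by (cases "i = j") auto

lemma finite_durfee_set:
  "finite {d. d \<le> length xs \<and> (0 < d \<longrightarrow> d \<le> xs ! (d - 1))}"
  by (rule finite_subset[of _ "{..length xs}"]) auto

lemma durfee_properties:
  "durfee xs \<le> length xs \<and> (0 < durfee xs \<longrightarrow> durfee xs \<le> xs ! (durfee xs - 1))"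
proof -
  have "durfee xs \<in> {d. d \<le> length xs \<and> (0 < d \<longrightarrow> d \<le> xs ! (d - 1))}"
    unfolding durfee_def by (intro Max_in finite_durfee_set) auto
  then show ?thesis
    by simp
qed

lemma block_take_durfee:
  assumes "is_partition xs"
  shows "block (take (durfee xs) xs)"
  unfolding block_def
proof
  fix x assume "x \<in> set (take (durfee xs) xs)"
  then obtain i where i: "i < durfee xs" "i < length xs" "x = xs ! i"
    by (auto simp: in_set_conv_nth)
  have "length (take (durfee xs) xs) \<le> durfee xs"
    by simp
  also have "\<dots> \<le> xs ! (durfee xs - 1)"
    using durfee_properties[of xs] i by simp
  \<comment> \<open>As \<open>i < durfee xs\<close>, the index \<open>i\<close> is at most
    \<open>durfee xs - 1\<close>, which is a valid index of \<open>xs\<close>.\<close>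
  also have "\<dots> \<le> x"
    unfolding i(3) using durfee_properties[of xs] i
    by (intro is_partition_nth_antimono[OF assms]) linarith+
  finally show "length (take (durfee xs) xs) \<le> x" .
qed

text \<open>The last part of a nonempty block is at least its length, so this length is a candidate
  in the maximum.\<close>

lemma block_prefix_le_durfee:
  assumes "block ys"
  shows "length ys \<le> durfee (ys @ zs)"
  unfolding durfee_def
proof (rule Max_ge[OF finite_durfee_set])
  show "length ys \<in> {d. d \<le> length (ys @ zs) \<and> (0 < d \<longrightarrow> d \<le> (ys @ zs) ! (d - 1))}"
    using assms by (auto simp: block_def nth_append)
qed

text \<open>The Durfee prefix is a block and reaches at least as far as the first block of any
  decomposition, so what it leaves is a suffix of the remaining blocks.\<close>

lemma concat_of_blocks_remove_durfee:
  assumes "is_partition xs"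
  shows "concat_of_blocks (Suc k) xs \<longleftrightarrow> concat_of_blocks k (remove_durfee xs)"
proof
  assume "concat_of_blocks (Suc k) xs"
  then obtain ys zs where "xs = ys @ zs" "block ys" "concat_of_blocks k zs"
    unfolding concat_of_blocks_Suc by blast
  then show "concat_of_blocks k (remove_durfee xs)"
    using block_prefix_le_durfee[of ys zs] concat_of_blocks_drop
    by (simp add: remove_durfee_def)
next
  assume "concat_of_blocks k (remove_durfee xs)"
  then show "concat_of_blocks (Suc k) xs"
    unfolding concat_of_blocks_Suc remove_durfee_def
    using block_take_durfee[OF assms] by (metis append_take_drop_id)
qed

text \<open>Truncated subtraction absorbs the minimum, and for \<open>[]\<close> the unspecified
  \<open>last []\<close> has no effect on \<open>take\<close>.\<close>

lemma remove_bottom_eq_take: "remove_bottom xs = take (length xs - last xs) xs"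
  unfolding remove_bottom_def by (auto simp: min_def)

text \<open>The suffix has at most \<open>last xs\<close> entries, and \<open>last xs\<close> is the
  smallest part.\<close>

lemma block_drop_bottom:
  assumes "is_partition xs"
  shows "block (drop (length xs - last xs) xs)"
  unfolding block_def
proof
  fix x assume "x \<in> set (drop (length xs - last xs) xs)"
  then have "x \<in> set xs"
    by (rule in_set_dropD)
  then obtain i where i: "i < length xs" "x = xs ! i"
    by (auto simp: in_set_conv_nth)
  have "length (drop (length xs - last xs) xs) \<le> last xs"
    by simp
  also have "\<dots> = xs ! (length xs - 1)"
    using i by (intro last_conv_nth) auto
  also have "\<dots> \<le> x"
    using is_partition_nth_antimono[OF assms, of i "length xs - 1"] i by simp
  finally show "length (drop (length xs - last xs) xs) \<le> x" .
qed

lemma concat_of_blocks_remove_bottom: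
  assumes "is_partition xs"
  shows "concat_of_blocks (Suc k) xs \<longleftrightarrow> concat_of_blocks k (remove_bottom xs)"
proof
  assume "concat_of_blocks (Suc k) xs"
  then obtain ys zs where *: "xs = ys @ zs" "concat_of_blocks k ys" "block zs"
    unfolding concat_of_blocks_Suc_snoc by blast
  have "remove_bottom xs = take (length xs - last xs) ys"
  proof (cases "zs = []")
    case True
    then show ?thesis
      using * by (simp add: remove_bottom_eq_take)
  next
    case False
    \<comment> \<open>The last part of \<open>xs\<close> lies in the block \<open>zs\<close>, so the
      cut removes all of \<open>zs\<close> and falls within \<open>ys\<close>.\<close>
    then have "length zs \<le> last xs"
      using * by (auto simp: block_def)
    then show ?thesis
      using * by (simp add: remove_bottom_eq_take)
  qed
  then show "concat_of_blocks k (remove_bottom xs)"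
    using * by (simp add: concat_of_blocks_take)
next
  assume "concat_of_blocks k (remove_bottom xs)"
  then show "concat_of_blocks (Suc k) xs"
    unfolding concat_of_blocks_Suc_snoc remove_bottom_eq_take
    using block_drop_bottom[OF assms] by (metis append_take_drop_id)
qed

lemma remove_durfee_funpow_Nil_iff:
  "is_partition xs \<Longrightarrow> (remove_durfee ^^ k) xs = [] \<longleftrightarrow> concat_of_blocks k xs"
proof (induction k arbitrary: xs)
  case (Suc k)
  have "is_partition (remove_durfee xs)"
    unfolding remove_durfee_def using Suc.prems by (rule is_partition_drop)
  then show ?case
    \<comment> \<open>The first removal is split off, not the last, so that the induction hypothesis
      applies to the partition left after one step.\<close>
    using Suc by (simp add: funpow_Suc_right concat_of_blocks_remove_durfee del: funpow.simps)
qed (simp add: concat_of_blocks_0)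

lemma remove_bottom_funpow_Nil_iff:
  "is_partition xs \<Longrightarrow> (remove_bottom ^^ k) xs = [] \<longleftrightarrow> concat_of_blocks k xs"
proof (induction k arbitrary: xs)
  case (Suc k)
  have "is_partition (remove_bottom xs)"
    unfolding remove_bottom_eq_take using Suc.prems by (rule is_partition_take)
  then show ?case
    using Suc by (simp add: funpow_Suc_right concat_of_blocks_remove_bottom del: funpow.simps)
qed (simp add: concat_of_blocks_0)

theorem theorem3p3:
  fixes r :: nat
  assumes "r \<ge> 2"
  shows "B_diag r = D_diag r"
  unfolding B_diag_def D_diag_def
  by (auto simp: remove_bottom_funpow_Nil_iff remove_durfee_funpow_Nil_iff)

end
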